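(* $\mathcal{E}(G_2)=10$, and for every integer $t\ge2$, $$\mathcal{E}(G_{2^t})\ge2^{4\lfloor t/2\rfloor+1}-4.$$
   Context: For $n\ge2$, $\mathbb{L}_n=\{a+bi+cj+dk: a,b,c,d\in\mathbb{Z}/n\mathbb{Z}\}$ is the ring of Lipschitz quaternions modulo $n$, with the usual relations $i^2=j^2=k^2=-1$, $ij=k=-ji$, $jk=i=-kj$, $ki=j=-ik$ taken modulo $n$. A nonzero element $x$ of a ring is a zero divisor if $xy=0$ or $yx=0$ for some nonzero $y$. $G_n=\Gamma(\mathbb{L}_n)$ is the simple undirected graph whose vertices are the nonzero zero divisors of $\mathbb{L}_n$, distinct $x,y$ being adjacent iff $xy=0$ or $yx=0$. The energy $\mathcal{E}(G)$ of a graph $G$ is the sum of the absolute values of the eigenvalues (with multiplicity) of its adjacency matrix. *)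

theory Defs
  imports
    "HOL-Number_Theory.Residues"
    "Graph_Theory.Pair_Digraph"
    "Jordan_Normal_Form.Spectral_Radius"
begin

section \<open>Lipschitz quaternions modulo n\<close>

text \<open>A quaternion \<open>a + b i + c j + d k\<close> over a ring is encoded as the tuple \<open>(a, b, c, d)\<close>.
  The product is the bilinear extension of \<open>i\<^sup>2 = j\<^sup>2 = k\<^sup>2 = -1\<close>, \<open>i j = k = - j i\<close>,
  \<open>j k = i = - k j\<close>, \<open>k i = j = - i k\<close>.\<close>

definition quaternion_mult ::
    "('a, 'b) ring_scheme \<Rightarrow> 'a \<times> 'a \<times> 'a \<times> 'a \<Rightarrow> 'a \<times> 'a \<times> 'a \<times> 'a \<Rightarrow> 'a \<times> 'a \<times> 'a \<times> 'a" where
  "quaternion_mult R = (\<lambda>(a, b, c, d) (a', b', c', d').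
     (a \<otimes>\<^bsub>R\<^esub> a' \<ominus>\<^bsub>R\<^esub> b \<otimes>\<^bsub>R\<^esub> b' \<ominus>\<^bsub>R\<^esub> c \<otimes>\<^bsub>R\<^esub> c' \<ominus>\<^bsub>R\<^esub> d \<otimes>\<^bsub>R\<^esub> d',
      a \<otimes>\<^bsub>R\<^esub> b' \<oplus>\<^bsub>R\<^esub> b \<otimes>\<^bsub>R\<^esub> a' \<oplus>\<^bsub>R\<^esub> c \<otimes>\<^bsub>R\<^esub> d' \<ominus>\<^bsub>R\<^esub> d \<otimes>\<^bsub>R\<^esub> c',
      a \<otimes>\<^bsub>R\<^esub> c' \<ominus>\<^bsub>R\<^esub> b \<otimes>\<^bsub>R\<^esub> d' \<oplus>\<^bsub>R\<^esub> c \<otimes>\<^bsub>R\<^esub> a' \<oplus>\<^bsub>R\<^esub> d \<otimes>\<^bsub>R\<^esub> b',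
      a \<otimes>\<^bsub>R\<^esub> d' \<oplus>\<^bsub>R\<^esub> b \<otimes>\<^bsub>R\<^esub> c' \<ominus>\<^bsub>R\<^esub> c \<otimes>\<^bsub>R\<^esub> b' \<oplus>\<^bsub>R\<^esub> d \<otimes>\<^bsub>R\<^esub> a'))"

definition quaternion_ring :: "('a, 'b) ring_scheme \<Rightarrow> ('a \<times> 'a \<times> 'a \<times> 'a) ring" where
  "quaternion_ring R =
     \<lparr>carrier = carrier R \<times> carrier R \<times> carrier R \<times> carrier R,
      monoid.mult = quaternion_mult R,
      one = (\<one>\<^bsub>R\<^esub>, \<zero>\<^bsub>R\<^esub>, \<zero>\<^bsub>R\<^esub>, \<zero>\<^bsub>R\<^esub>),
      zero = (\<zero>\<^bsub>R\<^esub>, \<zero>\<^bsub>R\<^esub>, \<zero>\<^bsub>R\<^esub>, \<zero>\<^bsub>R\<^esub>),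
      add = (\<lambda>(a, b, c, d) (a', b', c', d').
        (a \<oplus>\<^bsub>R\<^esub> a', b \<oplus>\<^bsub>R\<^esub> b', c \<oplus>\<^bsub>R\<^esub> c', d \<oplus>\<^bsub>R\<^esub> d'))\<rparr>"

definition lipschitz :: "int \<Rightarrow> (int \<times> int \<times> int \<times> int) ring" where
  "lipschitz n = quaternion_ring (residue_ring n)"

lemma lipschitz_carrier:
  "carrier (lipschitz n) = {0..n - 1} \<times> {0..n - 1} \<times> {0..n - 1} \<times> {0..n - 1}"
  by (simp add: lipschitz_def quaternion_ring_def residue_ring_def)

lemma lipschitz_zero: "\<zero>\<^bsub>lipschitz n\<^esub> = (0, 0, 0, 0)"
  by (simp add: lipschitz_def quaternion_ring_def residue_ring_def)

lemma lipschitz_one: "\<one>\<^bsub>lipschitz n\<^esub> = (1, 0, 0, 0)"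
  by (simp add: lipschitz_def quaternion_ring_def residue_ring_def)

lemma lipschitz_add:
  "(a, b, c, d) \<oplus>\<^bsub>lipschitz n\<^esub> (a', b', c', d') =
     ((a + a') mod n, (b + b') mod n, (c + c') mod n, (d + d') mod n)"
  by (simp add: lipschitz_def quaternion_ring_def residue_ring_def)

lemma residue_ring_minus:
  assumes "n \<ge> 2"
  shows "x \<ominus>\<^bsub>residue_ring n\<^esub> (y mod n) = (x - y) mod n"
proof -
  interpret residues n "residue_ring n"
    by unfold_locales (use assms in auto)
  have "x \<ominus>\<^bsub>residue_ring n\<^esub> (y mod n) = (x + (- (y mod n)) mod n) mod n"
    unfolding a_minus_def res_neg_eq by (simp add: residue_ring_def)
  then show ?thesis by (simp add: mod_simps)
qed

lemma lipschitz_mult: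
  assumes "n \<ge> 2"
  shows "(a, b, c, d) \<otimes>\<^bsub>lipschitz n\<^esub> (a', b', c', d') =
     ((a * a' - b * b' - c * c' - d * d') mod n,
      (a * b' + b * a' + c * d' - d * c') mod n,
      (a * c' - b * d' + c * a' + d * b') mod n,
      (a * d' + b * c' - c * b' + d * a') mod n)"
  using residue_ring_minus[OF assms]
  by (simp add: lipschitz_def quaternion_ring_def quaternion_mult_def)
     (simp add: residue_ring_def mod_simps)

lemma lipschitz_mod_absorb:
  assumes "n \<ge> 2"
  shows "(a mod n, b mod n, c mod n, d mod n) \<otimes>\<^bsub>lipschitz n\<^esub> (a', b', c', d') =
           (a, b, c, d) \<otimes>\<^bsub>lipschitz n\<^esub> (a', b', c', d')"
    and "(a, b, c, d) \<otimes>\<^bsub>lipschitz n\<^esub> (a' mod n, b' mod n, c' mod n, d' mod n) =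
           (a, b, c, d) \<otimes>\<^bsub>lipschitz n\<^esub> (a', b', c', d')"
    and "(a mod n, b mod n, c mod n, d mod n) \<oplus>\<^bsub>lipschitz n\<^esub> (a', b', c', d') =
           (a, b, c, d) \<oplus>\<^bsub>lipschitz n\<^esub> (a', b', c', d')"
    and "(a, b, c, d) \<oplus>\<^bsub>lipschitz n\<^esub> (a' mod n, b' mod n, c' mod n, d' mod n) =
           (a, b, c, d) \<oplus>\<^bsub>lipschitz n\<^esub> (a', b', c', d')"
  unfolding lipschitz_mult[OF assms] lipschitz_add prod.inject cong_def[symmetric]
  by (intro conjI cong_add cong_diff cong_mult cong_refl; simp add: cong_def)+

lemma lipschitz_ring:
  assumes "n \<ge> 2"
  shows "ring (lipschitz n)"
proof -
  let ?L = "lipschitz n"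
  note absorb = lipschitz_mod_absorb[OF assms] and mult = lipschitz_mult[OF assms]
  have closed: "x \<oplus>\<^bsub>?L\<^esub> y \<in> carrier ?L" "x \<otimes>\<^bsub>?L\<^esub> y \<in> carrier ?L" for x y
    using assms by (cases x; cases y; auto simp: lipschitz_carrier lipschitz_add mult)+
  have add_assoc: "(x \<oplus>\<^bsub>?L\<^esub> y) \<oplus>\<^bsub>?L\<^esub> z = x \<oplus>\<^bsub>?L\<^esub> (y \<oplus>\<^bsub>?L\<^esub> z)" for x y z
    by (cases x; cases y; cases z) (simp add: lipschitz_add mod_simps add_ac)
  have mult_assoc: "(x \<otimes>\<^bsub>?L\<^esub> y) \<otimes>\<^bsub>?L\<^esub> z = x \<otimes>\<^bsub>?L\<^esub> (y \<otimes>\<^bsub>?L\<^esub> z)" for x y z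
  proof -
    obtain a b c d where x: "x = (a, b, c, d)" by (cases x) auto
    obtain a' b' c' d' where y: "y = (a', b', c', d')" by (cases y) auto
    obtain a'' b'' c'' d'' where z: "z = (a'', b'', c'', d'')" by (cases z) auto
    show ?thesis
      unfolding x y z mult[of a b c d a' b' c' d'] mult[of a' b' c' d' a'' b'' c'' d''] absorb
      unfolding mult by (simp add: algebra_simps)
  qed
  have l_distr: "(x \<oplus>\<^bsub>?L\<^esub> y) \<otimes>\<^bsub>?L\<^esub> z = x \<otimes>\<^bsub>?L\<^esub> z \<oplus>\<^bsub>?L\<^esub> y \<otimes>\<^bsub>?L\<^esub> z"
    and r_distr: "z \<otimes>\<^bsub>?L\<^esub> (x \<oplus>\<^bsub>?L\<^esub> y) = z \<otimes>\<^bsub>?L\<^esub> x \<oplus>\<^bsub>?L\<^esub> z \<otimes>\<^bsub>?L\<^esub> y" for x y z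
  proof -
    obtain a b c d where x: "x = (a, b, c, d)" by (cases x) auto
    obtain a' b' c' d' where y: "y = (a', b', c', d')" by (cases y) auto
    obtain a'' b'' c'' d'' where z: "z = (a'', b'', c'', d'')" by (cases z) auto
    show "(x \<oplus>\<^bsub>?L\<^esub> y) \<otimes>\<^bsub>?L\<^esub> z = x \<otimes>\<^bsub>?L\<^esub> z \<oplus>\<^bsub>?L\<^esub> y \<otimes>\<^bsub>?L\<^esub> z"
      unfolding x y z mult[of a b c d a'' b'' c'' d''] mult[of a' b' c' d' a'' b'' c'' d'']
        lipschitz_add[where a = a and b = b and c = c and d = d and a' = a' and b' = b' and c' = c' and d' = d'] absorb
      unfolding mult lipschitz_add by (simp add: algebra_simps)
    show "z \<otimes>\<^bsub>?L\<^esub> (x \<oplus>\<^bsub>?L\<^esub> y) = z \<otimes>\<^bsub>?L\<^esub> x \<oplus>\<^bsub>?L\<^esub> z \<otimes>\<^bsub>?L\<^esub> y"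
      unfolding x y z mult[of a'' b'' c'' d'' a b c d] mult[of a'' b'' c'' d'' a' b' c' d']
        lipschitz_add[where a = a and b = b and c = c and d = d and a' = a' and b' = b' and c' = c' and d' = d'] absorb
      unfolding mult lipschitz_add by (simp add: algebra_simps)
  qed
  have "abelian_group ?L"
  proof (rule abelian_groupI)
    fix x assume "x \<in> carrier ?L"
    then obtain a b c d where "x = (a, b, c, d)" by (cases x) auto
    then show "\<exists>y\<in>carrier ?L. y \<oplus>\<^bsub>?L\<^esub> x = \<zero>\<^bsub>?L\<^esub>"
      using assms
      by (intro bexI[of _ "((- a) mod n, (- b) mod n, (- c) mod n, (- d) mod n)"])
         (auto simp: lipschitz_carrier lipschitz_zero lipschitz_add mod_simps)
  qed (use assms closed add_assoc in
        \<open>auto simp: lipschitz_carrier lipschitz_zero lipschitz_add add_ac\<close>)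
  moreover have "monoid ?L"
    by (rule monoidI)
       (use assms closed mult_assoc in \<open>auto simp: lipschitz_carrier lipschitz_one mult\<close>)
  ultimately show ?thesis
    using l_distr r_distr by (intro ringI) auto
qed

lemma lipschitz_relations:
  assumes "n \<ge> 2"
  defines "L \<equiv> lipschitz n"
  defines "i \<equiv> (0, 1, 0, 0)" and "j \<equiv> (0, 0, 1, 0)" and "k \<equiv> (0, 0, 0, 1)"
  shows "i \<otimes>\<^bsub>L\<^esub> i = \<ominus>\<^bsub>L\<^esub> \<one>\<^bsub>L\<^esub>" "j \<otimes>\<^bsub>L\<^esub> j = \<ominus>\<^bsub>L\<^esub> \<one>\<^bsub>L\<^esub>" "k \<otimes>\<^bsub>L\<^esub> k = \<ominus>\<^bsub>L\<^esub> \<one>\<^bsub>L\<^esub>"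
    "i \<otimes>\<^bsub>L\<^esub> j = k" "j \<otimes>\<^bsub>L\<^esub> i = \<ominus>\<^bsub>L\<^esub> k"
    "j \<otimes>\<^bsub>L\<^esub> k = i" "k \<otimes>\<^bsub>L\<^esub> j = \<ominus>\<^bsub>L\<^esub> i"
    "k \<otimes>\<^bsub>L\<^esub> i = j" "i \<otimes>\<^bsub>L\<^esub> k = \<ominus>\<^bsub>L\<^esub> j"
proof -
  interpret ring L unfolding L_def by (rule lipschitz_ring[OF assms(1)])
  have neg: "\<ominus>\<^bsub>L\<^esub> (a, b, c, d) = ((- a) mod n, (- b) mod n, (- c) mod n, (- d) mod n)"
    if "(a, b, c, d) \<in> carrier L" for a b c d
    by (rule minus_equality)
       (use assms(1) that in \<open>auto simp: L_def lipschitz_carrier lipschitz_zero lipschitz_add mod_simps\<close>)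
  show "i \<otimes>\<^bsub>L\<^esub> i = \<ominus>\<^bsub>L\<^esub> \<one>\<^bsub>L\<^esub>" "j \<otimes>\<^bsub>L\<^esub> j = \<ominus>\<^bsub>L\<^esub> \<one>\<^bsub>L\<^esub>" "k \<otimes>\<^bsub>L\<^esub> k = \<ominus>\<^bsub>L\<^esub> \<one>\<^bsub>L\<^esub>"
    "i \<otimes>\<^bsub>L\<^esub> j = k" "j \<otimes>\<^bsub>L\<^esub> i = \<ominus>\<^bsub>L\<^esub> k"
    "j \<otimes>\<^bsub>L\<^esub> k = i" "k \<otimes>\<^bsub>L\<^esub> j = \<ominus>\<^bsub>L\<^esub> i"
    "k \<otimes>\<^bsub>L\<^esub> i = j" "i \<otimes>\<^bsub>L\<^esub> k = \<ominus>\<^bsub>L\<^esub> j"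
    using assms(1) neg
    by (auto simp: i_def j_def k_def L_def lipschitz_carrier lipschitz_one lipschitz_mult)
qed

section \<open>Zero-divisor graphs\<close>

definition nonzero_zero_divisors :: "('a, 'b) ring_scheme \<Rightarrow> 'a set" where
  "nonzero_zero_divisors R =
     {x \<in> carrier R - {\<zero>\<^bsub>R\<^esub>}. \<exists>y \<in> carrier R - {\<zero>\<^bsub>R\<^esub>}. x \<otimes>\<^bsub>R\<^esub> y = \<zero>\<^bsub>R\<^esub> \<or> y \<otimes>\<^bsub>R\<^esub> x = \<zero>\<^bsub>R\<^esub>}"

text \<open>An undirected edge is represented by its two opposite arcs.\<close>

definition zero_divisor_graph :: "('a, 'b) ring_scheme \<Rightarrow> 'a pair_pre_digraph" where
  "zero_divisor_graph R =
     \<lparr>pverts = nonzero_zero_divisors R,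
      parcs = {(x, y). x \<in> nonzero_zero_divisors R \<and> y \<in> nonzero_zero_divisors R \<and> x \<noteq> y \<and>
                 (x \<otimes>\<^bsub>R\<^esub> y = \<zero>\<^bsub>R\<^esub> \<or> y \<otimes>\<^bsub>R\<^esub> x = \<zero>\<^bsub>R\<^esub>)}\<rparr>"

lemma pair_graph_zero_divisor_graph:
  assumes "finite (carrier R)"
  shows "pair_graph (zero_divisor_graph R)"
proof -
  have fin: "finite (nonzero_zero_divisors R)"
    using assms by (simp add: nonzero_zero_divisors_def)
  then have fin_arcs: "finite (parcs (zero_divisor_graph R))"
    by (rule_tac finite_subset[of _ "nonzero_zero_divisors R \<times> nonzero_zero_divisors R"])
       (auto simp: zero_divisor_graph_def)
  show ?thesis
    by unfold_locales
       (use fin fin_arcs in \<open>auto simp: zero_divisor_graph_def symmetric_def intro!: symI\<close>)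
qed

definition lipschitz_graph :: "int \<Rightarrow> (int \<times> int \<times> int \<times> int) pair_pre_digraph" where
  "lipschitz_graph n = zero_divisor_graph (lipschitz n)"

lemma pair_graph_lipschitz_graph: "pair_graph (lipschitz_graph n)"
  unfolding lipschitz_graph_def
  by (rule pair_graph_zero_divisor_graph) (simp add: lipschitz_carrier)

section \<open>Graph energy\<close>

text \<open>Matrices are indexed by natural numbers, so the adjacency matrix is taken with respect to an
  enumeration of the vertices.  Its entries are read as complex numbers, so that the spectrum
  contains every root of the characteristic polynomial; multiplicities are the algebraic ones.\<close>

definition adjacency_matrix :: "'a pair_pre_digraph \<Rightarrow> 'a list \<Rightarrow> complex mat" where
  "adjacency_matrix G vs =
     mat (length vs) (length vs) (\<lambda>(r, s). if (vs ! r, vs ! s) \<in> parcs G then 1 else 0)"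

definition matrix_energy :: "complex mat \<Rightarrow> real" where
  "matrix_energy A = (\<Sum>z \<in> spectrum A. real (order z (char_poly A)) * cmod z)"

text \<open>Meaningful for finite graphs only; by \<open>graph_energy_eq\<close> below the chosen enumeration does
  not matter.\<close>

definition graph_energy :: "'a pair_pre_digraph \<Rightarrow> real" where
  "graph_energy G =
     matrix_energy (adjacency_matrix G (SOME vs. distinct vs \<and> set vs = pverts G))"

lemma similar_adjacency_matrix:
  assumes vs: "distinct vs" and ws: "distinct ws" and eq: "set vs = set ws"
  shows "similar_mat (adjacency_matrix G vs) (adjacency_matrix G ws)"
proof -
  define n where "n = length vs"
  have n: "length vs = n" "length ws = n"
    using vs ws eq by (auto simp: n_def distinct_card[symmetric])
  define A where "A = adjacency_matrix G vs"
  define B where "B = adjacency_matrix G ws"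
  define P where "P = mat n n (\<lambda>(r, s). if vs ! r = ws ! s then 1 else (0 :: complex))"
  define Q where "Q = mat n n (\<lambda>(r, s). if ws ! r = vs ! s then 1 else (0 :: complex))"
  have dims: "A \<in> carrier_mat n n" "B \<in> carrier_mat n n" "P \<in> carrier_mat n n" "Q \<in> carrier_mat n n"
    by (auto simp: A_def B_def P_def Q_def adjacency_matrix_def n)
  have pos: "\<exists>q<n. \<forall>s<n. (xs ! r = ys ! s) = (s = q)"
    if "r < n" "distinct ys" "length ys = n" "length xs = n" "set xs = set ys" for xs ys :: "'a list" and r
  proof -
    have "xs ! r \<in> set ys" using that nth_mem[of r xs] by simp
    then obtain q where q: "q < n" "ys ! q = xs ! r" using \<open>length ys = n\<close>
      by (auto simp: in_set_conv_nth)
    have "(xs ! r = ys ! s) = (s = q)" if "s < n" for s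
      using q that \<open>distinct ys\<close> \<open>length ys = n\<close> nth_eq_iff_index_eq[of ys q s] by auto
    with q show ?thesis by blast
  qed
  have sum_one: "(\<Sum>s = 0..<n. (if xs ! r = ys ! s then 1 else 0) * f s) = f q"
    if "q < n" "\<forall>s<n. (xs ! r = ys ! s) = (s = q)" for xs ys :: "'a list" and r q and f :: "nat \<Rightarrow> complex"
  proof -
    have "(\<Sum>s = 0..<n. (if xs ! r = ys ! s then 1 else 0) * f s) = (\<Sum>s = 0..<n. if s = q then f s else 0)"
      by (rule sum.cong) (use that in auto)
    then show ?thesis using that by simp
  qed
  have inv: "mat n n (\<lambda>(r, s). if xs ! r = ys ! s then 1 else (0 :: complex)) *
             mat n n (\<lambda>(r, s). if ys ! r = xs ! s then 1 else 0) = 1\<^sub>m n"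
    if d: "distinct xs" "distinct ys" "length ys = n" "length xs = n" "set xs = set ys" for xs ys :: "'a list"
  proof (rule eq_matI)
    fix r s assume "r < dim_row (1\<^sub>m n :: complex mat)" "s < dim_col (1\<^sub>m n :: complex mat)"
    then have rs: "r < n" "s < n" by auto
    obtain q where q: "q < n" "\<forall>s<n. (xs ! r = ys ! s) = (s = q)" using pos[OF rs(1) d(2-5)] by blast
    have "ys ! q = xs ! s \<longleftrightarrow> r = s"
      using q rs d nth_eq_iff_index_eq[of xs r s] by auto
    then show "(mat n n (\<lambda>(r, s). if xs ! r = ys ! s then 1 else (0 :: complex)) *
             mat n n (\<lambda>(r, s). if ys ! r = xs ! s then 1 else 0)) $$ (r, s) = 1\<^sub>m n $$ (r, s)"
      using rs sum_one[OF q] by (simp add: scalar_prod_def)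
  qed auto
  have PQ: "P * Q = 1\<^sub>m n" and QP: "Q * P = 1\<^sub>m n"
    unfolding P_def Q_def using inv vs ws n eq by auto
  have AP: "A * P = P * B"
  proof (rule eq_matI)
    fix r s assume "r < dim_row (P * B)" "s < dim_col (P * B)"
    then have rs: "r < n" "s < n" using dims by auto
    obtain q where q: "q < n" "\<forall>s<n. (vs ! r = ws ! s) = (s = q)"
      using pos[OF rs(1) ws n(2,1) eq] by blast
    obtain p where p: "p < n" "\<forall>t<n. (ws ! s = vs ! t) = (t = p)"
      using pos[OF rs(2) vs n(1,2) eq[symmetric]] by blast
    have l: "(A * P) $$ (r, s) =
        (\<Sum>t = 0..<n. (if ws ! s = vs ! t then 1 else 0) * (if (vs ! r, vs ! t) \<in> parcs G then 1 else 0))"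
      using rs n by (auto simp: A_def P_def adjacency_matrix_def scalar_prod_def intro!: sum.cong)
    have m: "(P * B) $$ (r, s) =
        (\<Sum>t = 0..<n. (if vs ! r = ws ! t then 1 else 0) * (if (ws ! t, ws ! s) \<in> parcs G then 1 else 0))"
      using rs n by (auto simp: B_def P_def adjacency_matrix_def scalar_prod_def intro!: sum.cong)
    have "vs ! p = ws ! s" "ws ! q = vs ! r" using p q by auto
    then show "(A * P) $$ (r, s) = (P * B) $$ (r, s)"
      unfolding l m sum_one[OF p] sum_one[OF q] by simp
  qed (use dims in auto)
  have "A = A * (P * Q)" using dims PQ by simp
  also have "\<dots> = P * B * Q" using dims AP by (simp flip: assoc_mult_mat[of A n n P n Q n])
  finally have "similar_mat_wit A B P Q"
    using dims PQ QP by (intro similar_mat_witI[of _ _ n]) auto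
  then show ?thesis unfolding similar_mat_def A_def B_def by blast
qed

lemma graph_energy_eq:
  assumes "distinct vs" "set vs = pverts G"
  shows "graph_energy G = matrix_energy (adjacency_matrix G vs)"
proof -
  define ws where "ws = (SOME vs. distinct vs \<and> set vs = pverts G)"
  have ws: "distinct ws \<and> set ws = pverts G"
    unfolding ws_def by (rule someI[of _ vs]) (use assms in auto)
  have cp: "char_poly (adjacency_matrix G ws) = char_poly (adjacency_matrix G vs)"
    by (rule char_poly_similar, rule similar_adjacency_matrix) (use ws assms in auto)
  have carr: "adjacency_matrix G us \<in> carrier_mat (length us) (length us)" for us
    by (simp add: adjacency_matrix_def)
  have "spectrum (adjacency_matrix G ws) = spectrum (adjacency_matrix G vs)"
    unfolding spectrum_def using eigenvalue_root_char_poly[OF carr] cp by auto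
  then show ?thesis unfolding graph_energy_def ws_def[symmetric] matrix_energy_def cp by simp
qed

end

theory Submission
  imports Defs
begin

text \<open>
  The lower bound comes from a large clique. Put \<open>m = \<lfloor>t/2\<rfloor>\<close> and \<open>s = 2\<^sup>t\<^sup>-\<^sup>m\<close>. Modulo \<open>2\<^sup>t\<close> the product
  of any two multiples of \<open>s\<close> is a multiple of \<open>s\<^sup>2\<close>, hence zero, and there are \<open>16\<^sup>m - 1\<close> nonzero
  quaternions all of whose coordinates are multiples of \<open>s\<close>. They form a clique with \<open>N = 16\<^sup>m - 1\<close>
  vertices, and \<open>2 (N - 1)\<close> is exactly the claimed bound.

  A clique on \<open>N\<close> vertices forces energy at least \<open>2 (N - 1)\<close> for two reasons. First, the number of
  walks of length \<open>k\<close> inside the clique starting from a given vertex is \<open>(N - 1)\<^sup>k\<close>, so the powers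
  of the adjacency matrix grow at least at the rate \<open>N - 1\<close>; as powers of a matrix of spectral
  radius below one stay bounded, some eigenvalue \<open>z\<close> has \<open>|z| \<ge> N - 1\<close>
  (lemma \<open>ex_eigenvalue_ge_block_row_sum\<close>). Second, an adjacency matrix has trace zero, so the
  eigenvalues other than \<open>z\<close> add up to \<open>- z\<close> and their absolute values contribute at least \<open>|z|\<close>
  once more (lemma \<open>matrix_energy_ge_eigenvalue\<close>).

  Modulo two, a quaternion squares to the parity of the sum of its coordinates. Those with odd sum are
  therefore units, and the zero divisors are the seven nonzero ones with even sum. Here \<open>1 + i + j + k\<close>
  annihilates all the others, and these are matched in three complementary pairs such as
  \<open>1 + i\<close>, \<open>j + k\<close>. So the graph consists of three triangles glued at one vertex, and its
  eigenvalues are \<open>3\<close>, \<open>-2\<close>, three times \<open>-1\<close> and twice \<open>1\<close>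
  (lemma \<open>friendship_matrix_energy\<close>).
\<close>

section \<open>Energy through the list of eigenvalues\<close>

lemma sum_count_list_mult:
  fixes f :: "'a \<Rightarrow> 'b :: semiring_1"
  assumes "finite X" "set xs \<subseteq> X"
  shows "(\<Sum>x\<in>X. of_nat (count_list xs x) * f x) = (\<Sum>x\<leftarrow>xs. f x)"
  using assms(2)
proof (induction xs)
  case (Cons a xs)
  have "(\<Sum>x\<in>X. of_nat (count_list (a # xs) x) * f x) =
      (\<Sum>x\<in>X. (if x = a then f x else 0) + of_nat (count_list xs x) * f x)"
    by (intro sum.cong) (auto simp: distrib_right)
  also have "\<dots> = f a + (\<Sum>x\<in>X. of_nat (count_list xs x) * f x)"
    using Cons.prems assms(1) by (simp add: sum.distrib)
  finally show ?case using Cons by simp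
qed simp

lemma order_linear_factors:
  fixes es :: "'a :: idom list"
  shows "Polynomial.order z (\<Prod>e\<leftarrow>es. [:- e, 1:]) = count_list es z"
proof (induction es)
  case (Cons e es)
  have nz: "(\<Prod>a\<leftarrow>es. [:- a, 1:]) \<noteq> 0"
    by auto
  have "Polynomial.order z [:- e, 1:] = (if e = z then 1 else 0)"
    using order_power_n_n[of z 1] by (auto intro: order_0I)
  then show ?case
    using Cons nz by (simp add: order_mult del: mult_pCons_left)
qed simp

lemma matrix_energy_eq_sum_list:
  assumes A: "A \<in> carrier_mat n n" and cp: "char_poly A = (\<Prod>e\<leftarrow>es. [:- e, 1:])"
  shows "matrix_energy A = (\<Sum>e\<leftarrow>es. cmod e)"
proof -
  have "spectrum A = set es"
    unfolding spectrum_root_char_poly[OF A] cp by (auto simp: poly_prod_list)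
  then show ?thesis
    unfolding matrix_energy_def cp order_linear_factors
    by (simp add: sum_count_list_mult)
qed

text \<open>Cyclicity of the trace; it makes the trace a similarity invariant.\<close>

lemma sum_diag_mult_commute:
  fixes A B :: "'a :: comm_semiring_0 mat"
  assumes "A \<in> carrier_mat n n" "B \<in> carrier_mat n n"
  shows "(\<Sum>i<n. (A * B) $$ (i, i)) = (\<Sum>i<n. (B * A) $$ (i, i))"
proof -
  have "(\<Sum>i<n. (A * B) $$ (i, i)) = (\<Sum>i<n. \<Sum>j<n. A $$ (i, j) * B $$ (j, i))"
    using assms by (simp add: scalar_prod_def lessThan_atLeast0)
  also have "\<dots> = (\<Sum>i<n. \<Sum>j<n. A $$ (j, i) * B $$ (i, j))"
    by (rule sum.swap)
  also have "\<dots> = (\<Sum>i<n. (B * A) $$ (i, i))"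
    using assms by (simp add: scalar_prod_def lessThan_atLeast0 mult.commute)
  finally show ?thesis .
qed

text \<open>Schur triangularisation puts the roots of the characteristic polynomial on the diagonal of a
  similar matrix, which has the same trace.\<close>

lemma sum_diag_eq_sum_list:
  fixes A :: "complex mat"
  assumes A: "A \<in> carrier_mat n n" and cp: "char_poly A = (\<Prod>e\<leftarrow>es. [:- e, 1:])"
  shows "(\<Sum>i<n. A $$ (i, i)) = sum_list es"
proof -
  obtain B P Q where "schur_decomposition A es = (B, P, Q)"
    by (cases "schur_decomposition A es") auto
  from schur_decomposition[OF A cp this]
  have wit: "similar_mat_wit A B P Q" and diag: "diag_mat B = es" by auto
  note W = similar_mat_witD2[OF A wit]
  have "(\<Sum>i<n. A $$ (i, i)) = (\<Sum>i<n. (P * (B * Q)) $$ (i, i))"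
    using W by (simp add: assoc_mult_mat[of P n n B n Q n])
  also have "\<dots> = (\<Sum>i<n. (B * Q * P) $$ (i, i))"
    using W by (intro sum_diag_mult_commute) auto
  also have "B * Q * P = B"
    using W by (simp add: assoc_mult_mat[of B n n Q n P n])
  also have "(\<Sum>i<n. B $$ (i, i)) = sum_list (diag_mat B)"
    using W by (simp add: diag_mat_def sum_list_distinct_conv_sum_set lessThan_atLeast0)
  finally show ?thesis using diag by simp
qed

text \<open>When the eigenvalues sum to zero, one of them has to be balanced by all the others together.\<close>

lemma matrix_energy_ge_eigenvalue:
  assumes A: "A \<in> carrier_mat n n" and tr: "(\<Sum>i<n. A $$ (i, i)) = 0"
    and z: "z \<in> spectrum A"
  shows "2 * cmod z \<le> matrix_energy A"
proof -
  obtain es where cp: "char_poly A = (\<Prod>e\<leftarrow>es. [:- e, 1:])"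
    using char_poly_factorized[OF A] by blast
  have "z \<in> set es"
    using z unfolding spectrum_root_char_poly[OF A] cp
    by (auto simp: poly_prod_list)
  then have split: "sum_list (map f es) = f z + sum_list (map f (remove1 z es))"
    for f :: "complex \<Rightarrow> 'b :: comm_monoid_add"
    by (rule sum_list_map_remove1)
  have "sum_list (remove1 z es) = - z"
    using split[of "\<lambda>e. e"] sum_diag_eq_sum_list[OF A cp] tr
    by (simp add: eq_neg_iff_add_eq_0 add.commute)
  moreover have "cmod (sum_list xs) \<le> (\<Sum>e\<leftarrow>xs. cmod e)" for xs
    by (induction xs) (auto intro: norm_triangle_le)
  ultimately have "cmod z \<le> (\<Sum>e\<leftarrow>remove1 z es. cmod e)"
    by (metis norm_minus_cancel)
  then show ?thesis
    using split[of cmod] matrix_energy_eq_sum_list[OF A cp] by simp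
qed

section \<open>Large eigenvalues of nonnegative matrices\<close>

text \<open>For a zero-one matrix the entries of the \<open>k\<close>-th power count walks of length \<open>k\<close>. Discarding the
  walks that leave \<open>S\<close> only decreases the counts, and each step inside \<open>S\<close> multiplies them by at
  least \<open>d\<close>.\<close>

lemma pow_mat_block_row_sum_ge:
  fixes M :: "real mat"
  assumes M: "M \<in> carrier_mat n n" and nonneg: "\<And>i j. i < n \<Longrightarrow> j < n \<Longrightarrow> 0 \<le> M $$ (i, j)"
    and S: "S \<subseteq> {..<n}" and d: "0 \<le> d" and row: "\<And>r. r \<in> S \<Longrightarrow> d \<le> (\<Sum>s\<in>S. M $$ (r, s))"
  shows "(\<forall>i<n. \<forall>j<n. 0 \<le> (M ^\<^sub>m k) $$ (i, j)) \<and>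
    (\<forall>r\<in>S. d ^ k \<le> (\<Sum>s\<in>S. (M ^\<^sub>m k) $$ (r, s)))"
proof (induction k)
  case 0
  have fin: "finite S" using S finite_subset by blast
  have "(\<Sum>s\<in>S. (1\<^sub>m n :: real mat) $$ (r, s)) = 1" if "r \<in> S" for r
  proof -
    have "(\<Sum>s\<in>S. (1\<^sub>m n :: real mat) $$ (r, s)) = (\<Sum>s\<in>S. if s = r then 1 else 0)"
      using S that by (intro sum.cong) (auto simp: subset_iff)
    then show ?thesis using that fin by simp
  qed
  then show ?case using M by simp
next
  case (Suc k)
  define N where "N = M ^\<^sub>m k"
  have N: "N \<in> carrier_mat n n" unfolding N_def using M by simp
  have Nnn: "0 \<le> N $$ (i, j)" if "i < n" "j < n" for i j
    using Suc that unfolding N_def by blast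
  have entry: "(N * M) $$ (i, j) = (\<Sum>u<n. N $$ (i, u) * M $$ (u, j))" if "i < n" "j < n" for i j
    using M N that by (simp add: scalar_prod_def lessThan_atLeast0)
  have "d ^ Suc k \<le> (\<Sum>s\<in>S. (N * M) $$ (r, s))" if r: "r \<in> S" for r
  proof -
    have "d ^ Suc k \<le> (\<Sum>u\<in>S. N $$ (r, u)) * d"
      using Suc r d unfolding N_def by (simp add: mult.commute mult_left_mono)
    also have "\<dots> \<le> (\<Sum>u\<in>S. N $$ (r, u) * (\<Sum>s\<in>S. M $$ (u, s)))"
      unfolding sum_distrib_right using S r row
      by (intro sum_mono mult_left_mono Nnn) (auto simp: subset_iff)
    also have "\<dots> = (\<Sum>s\<in>S. \<Sum>u\<in>S. N $$ (r, u) * M $$ (u, s))"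
      unfolding sum_distrib_left by (rule sum.swap)
    also have "\<dots> \<le> (\<Sum>s\<in>S. \<Sum>u<n. N $$ (r, u) * M $$ (u, s))"
      using S r nonneg Nnn by (intro sum_mono sum_mono2) (auto intro!: mult_nonneg_nonneg)
    also have "\<dots> = (\<Sum>s\<in>S. (N * M) $$ (r, s))"
      using S r by (intro sum.cong refl entry[symmetric]) (auto simp: subset_iff)
    finally show ?thesis .
  qed
  moreover have "0 \<le> (N * M) $$ (i, j)" if "i < n" "j < n" for i j
    using that nonneg Nnn unfolding entry[OF that] by (intro sum_nonneg mult_nonneg_nonneg) auto
  ultimately show ?case by (simp add: N_def)
qed

lemma eigenvalue_smult_mat:
  fixes A :: "complex mat"
  assumes A: "A \<in> carrier_mat n n" and c: "c \<noteq> 0" and ev: "eigenvalue (c \<cdot>\<^sub>m A) z"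
  shows "eigenvalue A (z / c)"
proof -
  obtain v where v: "v \<in> carrier_vec n" "v \<noteq> 0\<^sub>v n" and eq: "(c \<cdot>\<^sub>m A) *\<^sub>v v = z \<cdot>\<^sub>v v"
    using ev A unfolding eigenvalue_def eigenvector_def by auto
  have "(c \<cdot>\<^sub>m A) *\<^sub>v v = c \<cdot>\<^sub>v (A *\<^sub>v v)"
    using A v by (intro eq_vecI) auto
  with eq have "c \<cdot>\<^sub>v (A *\<^sub>v v) = z \<cdot>\<^sub>v v" by simp
  then have "A *\<^sub>v v = (z / c) \<cdot>\<^sub>v v"
    using c A v by (auto simp: vec_eq_iff field_simps)
  then show ?thesis
    using A v unfolding eigenvalue_def eigenvector_def by auto
qed

text \<open>If all eigenvalues were smaller than \<open>d\<close> in absolute value, then scaling by a number strictly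
  between the spectral radius and \<open>d\<close> would give a matrix of spectral radius below one, whose powers
  are bounded, but whose row sums over \<open>S\<close> are at least a number above one, so that those of its
  powers grow exponentially.\<close>

lemma ex_eigenvalue_ge_block_row_sum:
  fixes M :: "real mat"
  assumes M: "M \<in> carrier_mat n n" and nonneg: "\<And>i j. i < n \<Longrightarrow> j < n \<Longrightarrow> 0 \<le> M $$ (i, j)"
    and S: "S \<subseteq> {..<n}" "S \<noteq> {}" and row: "\<And>r. r \<in> S \<Longrightarrow> d \<le> (\<Sum>s\<in>S. M $$ (r, s))"
  shows "\<exists>z \<in> spectrum (map_mat complex_of_real M). d \<le> cmod z"
proof -
  define A where "A = map_mat complex_of_real M"
  have A: "A \<in> carrier_mat n n" using M by (simp add: A_def)
  have n: "n > 0" using S by auto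
  define \<rho> where "\<rho> = spectral_radius A"
  obtain z where z: "z \<in> spectrum A" "\<rho> = cmod z"
    using spectral_radius_mem_max(1)[OF A n] unfolding \<rho>_def by auto
  have "d \<le> \<rho>"
  proof (rule ccontr)
    assume "\<not> d \<le> \<rho>"
    define c where "c = (\<rho> + d) / 2"
    have c: "\<rho> < c" "c < d" "0 < c"
      using \<open>\<not> d \<le> \<rho>\<close> z(2) norm_ge_zero[of z] by (auto simp: c_def simp del: norm_ge_zero)
    define B where "B = (1 / c) \<cdot>\<^sub>m M"
    have B: "B \<in> carrier_mat n n" using M by (simp add: B_def)
    define C where "C = complex_of_real (1 / c) \<cdot>\<^sub>m A"
    have C: "C \<in> carrier_mat n n" using A by (simp add: C_def)
    have CB: "C = map_mat complex_of_real B"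
      unfolding B_def C_def A_def by auto
    have "spectral_radius C < 1"
    proof -
      obtain w where w: "w \<in> spectrum C" "spectral_radius C = cmod w"
        using spectral_radius_mem_max(1)[OF C n] by auto
      have "eigenvalue A (w / complex_of_real (1 / c))"
        using w(1) c unfolding C_def spectrum_def
        by (intro eigenvalue_smult_mat[OF A]) auto
      then have "cmod (w / complex_of_real (1 / c)) \<le> \<rho>"
        unfolding \<rho>_def by (intro spectral_radius_mem_max(2)[OF A n]) (auto simp: spectrum_def)
      then have "c * cmod w \<le> \<rho>"
        using c by (simp add: norm_mult mult.commute)
      also have "\<rho> < c * 1" using c by simp
      finally show ?thesis using c w(2) by (simp only: mult_less_cancel_left_pos)
    qed
    then obtain b where b: "\<And>k. norm_bound (C ^\<^sub>m k) b"
      using spectral_radius_jnf_norm_bound_less_1_upper_triangular[OF C] by blast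
    obtain r where r: "r \<in> S" using S by blast
    have growth: "(d / c) ^ k \<le> of_nat (card S) * b" for k
    proof -
      have "(d / c) ^ k \<le> (\<Sum>s\<in>S. (B ^\<^sub>m k) $$ (r, s))"
      proof -
        have "0 \<le> B $$ (i, j)" if "i < n" "j < n" for i j
          using that M nonneg c by (simp add: B_def)
        moreover have "d / c \<le> (\<Sum>s\<in>S. B $$ (q, s))" if "q \<in> S" for q
        proof -
          have "(\<Sum>s\<in>S. B $$ (q, s)) = (\<Sum>s\<in>S. M $$ (q, s)) / c"
            unfolding sum_divide_distrib
            using that S M by (intro sum.cong) (auto simp: B_def subset_iff)
          then show ?thesis using row[OF that] c by (simp add: divide_right_mono)
        qed
        ultimately show ?thesis
          using pow_mat_block_row_sum_ge[OF B _ S(1), of "d / c" k] r c by auto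
      qed
      also have "\<dots> \<le> (\<Sum>s\<in>S. b)"
      proof (rule sum_mono)
        fix s assume s: "s \<in> S"
        have rs: "r < n" "s < n" using r s S by auto
        have Bk: "B ^\<^sub>m k \<in> carrier_mat n n" using B by simp
        have Ck: "C ^\<^sub>m k = map_mat complex_of_real (B ^\<^sub>m k)"
          unfolding CB by (rule of_real_hom.mat_hom_pow[OF B, symmetric])
        have "cmod ((C ^\<^sub>m k) $$ (r, s)) \<le> b"
          using b[of k] rs C unfolding norm_bound_def by simp
        moreover have "(C ^\<^sub>m k) $$ (r, s) = complex_of_real ((B ^\<^sub>m k) $$ (r, s))"
          unfolding Ck using rs Bk by (intro index_map_mat) auto
        ultimately show "(B ^\<^sub>m k) $$ (r, s) \<le> b" by simp
      qed
      finally show ?thesis by simp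
    qed
    have "1 < d / c" using c by simp
    then obtain k where "of_nat (card S) * b < (d / c) ^ k"
      using real_arch_pow by blast
    then show False using growth[of k] by simp
  qed
  then show ?thesis using z unfolding A_def by auto
qed

section \<open>Cliques force energy\<close>

text \<open>In the rows and columns of a clique \<open>C\<close>, the adjacency matrix has row sums \<open>|C| - 1\<close>; without
  loops its trace is zero, which gives the factor two.\<close>

lemma graph_energy_ge_clique:
  assumes fin: "finite (pverts G)" and loopfree: "\<And>v. (v, v) \<notin> parcs G"
    and C: "C \<subseteq> pverts G" "C \<noteq> {}"
    and clique: "\<And>x y. x \<in> C \<Longrightarrow> y \<in> C \<Longrightarrow> x \<noteq> y \<Longrightarrow> (x, y) \<in> parcs G"
  shows "2 * (real (card C) - 1) \<le> graph_energy G"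
proof -
  obtain vs where vs: "distinct vs" "set vs = pverts G"
    using finite_distinct_list[OF fin] by blast
  define n where "n = length vs"
  define M where "M = mat n n (\<lambda>(r, s). if (vs ! r, vs ! s) \<in> parcs G then 1 else (0 :: real))"
  define A where "A = adjacency_matrix G vs"
  define S where "S = {r. r < n \<and> vs ! r \<in> C}"
  have MA: "A = map_mat complex_of_real M"
    unfolding A_def M_def adjacency_matrix_def n_def by (intro eq_matI) auto
  have M: "M \<in> carrier_mat n n" by (simp add: M_def)
  have A: "A \<in> carrier_mat n n" by (simp add: A_def adjacency_matrix_def n_def)
  have bij: "bij_betw ((!) vs) S C"
    unfolding bij_betw_def
  proof
    show "inj_on ((!) vs) S"
      using vs(1) by (auto simp: inj_on_def S_def n_def nth_eq_iff_index_eq)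
    show "(!) vs ` S = C"
    proof
      show "C \<subseteq> (!) vs ` S"
      proof
        fix x assume x: "x \<in> C"
        then have "x \<in> set vs" using C(1) vs(2) by blast
        then obtain i where "i < n" "vs ! i = x" by (auto simp: in_set_conv_nth n_def)
        with x show "x \<in> (!) vs ` S" by (auto simp: S_def)
      qed
    qed (auto simp: S_def)
  qed
  then have card: "card S = card C" by (rule bij_betw_same_card)
  have finS: "finite S" by (simp add: S_def)
  have S: "S \<subseteq> {..<n}" "S \<noteq> {}"
    using bij C(2) by (auto simp: S_def bij_betw_def)
  have row: "real (card C) - 1 \<le> (\<Sum>s\<in>S. M $$ (r, s))" if r: "r \<in> S" for r
  proof -
    have "card S > 0" using r finS by (auto simp: card_gt_0_iff)
    then have "real (card C) - 1 = (\<Sum>s\<in>S - {r}. 1)"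
      using r card by (simp add: card_Diff_singleton)
    also have "\<dots> = (\<Sum>s\<in>S - {r}. M $$ (r, s))"
    proof (rule sum.cong)
      fix s assume s: "s \<in> S - {r}"
      then have "vs ! r \<noteq> vs ! s"
        using r bij unfolding bij_betw_def inj_on_def by blast
      then show "1 = M $$ (r, s)"
        using r s clique by (auto simp: S_def M_def)
    qed simp
    also have "\<dots> \<le> (\<Sum>s\<in>S. M $$ (r, s))"
      using finS r by (intro sum_mono2) (auto simp: M_def S_def)
    finally show ?thesis .
  qed
  have "\<exists>z \<in> spectrum A. real (card C) - 1 \<le> cmod z"
    unfolding MA using row by (intro ex_eigenvalue_ge_block_row_sum[OF M _ S]) (auto simp: M_def)
  then obtain z where z: "z \<in> spectrum A" "real (card C) - 1 \<le> cmod z" by blast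
  have "(\<Sum>i<n. A $$ (i, i)) = 0"
    by (rule sum.neutral) (auto simp: A_def adjacency_matrix_def n_def loopfree)
  from matrix_energy_ge_eigenvalue[OF A this z(1)] z(2)
  show ?thesis unfolding graph_energy_eq[OF vs] A_def by simp
qed

text \<open>The products \<open>x \<otimes> x\<close> are included in the last assumption: they are what makes each element of
  \<open>S\<close> a zero divisor, even if \<open>S\<close> has only one element.\<close>

lemma zero_divisor_graph_energy_ge:
  assumes fin: "finite (carrier R)" and S: "S \<subseteq> carrier R - {\<zero>\<^bsub>R\<^esub>}" "S \<noteq> {}"
    and null: "\<And>x y. x \<in> S \<Longrightarrow> y \<in> S \<Longrightarrow> x \<otimes>\<^bsub>R\<^esub> y = \<zero>\<^bsub>R\<^esub>"
  shows "2 * (real (card S) - 1) \<le> graph_energy (zero_divisor_graph R)"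
proof -
  have sub: "S \<subseteq> nonzero_zero_divisors R"
    using S null unfolding nonzero_zero_divisors_def by blast
  show ?thesis
  proof (rule graph_energy_ge_clique)
    show "finite (pverts (zero_divisor_graph R))"
      using fin by (simp add: zero_divisor_graph_def nonzero_zero_divisors_def)
    show "(x, y) \<in> parcs (zero_divisor_graph R)" if "x \<in> S" "y \<in> S" "x \<noteq> y" for x y
      using that sub null by (auto simp: zero_divisor_graph_def)
  qed (use S sub in \<open>auto simp: zero_divisor_graph_def\<close>)
qed

text \<open>The clique consists of the \<open>k\<^sup>4 - 1\<close> nonzero quaternions whose coordinates are multiples of
  \<open>s\<close>; since the modulus \<open>s k\<close> divides \<open>s\<^sup>2\<close>, all their products vanish.\<close>

lemma lipschitz_graph_energy_ge:
  fixes s k :: nat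
  assumes s: "s \<ge> 1" and k: "k \<ge> 2" and dvd: "s * k dvd s * s"
  shows "2 * (real k ^ 4 - 2) \<le> graph_energy (lipschitz_graph (int (s * k)))"
proof -
  define n where "n = int (s * k)"
  define K where "K = {0..<int k}"
  define f where "f = (\<lambda>(a, b, c, d). (int s * a, int s * b, int s * c, int s * d))"
  define X where "X = f ` (K \<times> K \<times> K \<times> K - {(0, 0, 0, 0)})"
  have n: "n \<ge> 2"
  proof -
    have "1 * 2 \<le> s * k" using s k by (rule mult_le_mono)
    then show ?thesis unfolding n_def by linarith
  qed
  have ss: "n dvd int s * int s"
    using dvd unfolding n_def by (metis of_nat_dvd_iff of_nat_mult)
  have inj: "inj f"
    using s by (auto simp: f_def inj_def)
  have "card X = k ^ 4 - 1"
  proof -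
    have "card X = card (K \<times> K \<times> K \<times> K - {(0, 0, 0, 0)})"
      unfolding X_def by (rule card_image) (use inj in \<open>auto simp: inj_on_def inj_def\<close>)
    also have "\<dots> = card (K \<times> K \<times> K \<times> K) - 1"
      using k by (intro card_Diff_singleton) (auto simp: K_def)
    finally show ?thesis
      by (simp add: K_def card_cartesian_product power4_eq_xxxx mult.assoc)
  qed
  moreover have "2 ^ 4 \<le> k ^ 4" using k by (rule power_mono) simp
  ultimately have card: "real (card X) = real k ^ 4 - 1" "X \<noteq> {}"
    by auto
  have scaled: "int s * a \<in> {0..n - 1}" if "a \<in> K" for a
  proof -
    have "int s * a < int s * int k" using that s by (simp add: K_def)
    then show ?thesis using that by (simp add: n_def K_def)
  qed
  have f0: "f q = (0, 0, 0, 0) \<longleftrightarrow> q = (0, 0, 0, 0)" for q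
    using s by (cases q) (auto simp: f_def)
  have "X \<subseteq> carrier (lipschitz n) - {\<zero>\<^bsub>lipschitz n\<^esub>}"
  proof
    fix x assume "x \<in> X"
    then obtain q where q: "q \<in> K \<times> K \<times> K \<times> K" "q \<noteq> (0, 0, 0, 0)" "x = f q"
      unfolding X_def by blast
    have "x \<in> carrier (lipschitz n)"
      using q(1) scaled unfolding q(3)
      by (auto simp: f_def lipschitz_carrier simp del: atLeastAtMost_iff)
    moreover have "x \<noteq> \<zero>\<^bsub>lipschitz n\<^esub>"
      unfolding lipschitz_zero q(3) f0 by (rule q(2))
    ultimately show "x \<in> carrier (lipschitz n) - {\<zero>\<^bsub>lipschitz n\<^esub>}" by blast
  qed
  moreover have "x \<otimes>\<^bsub>lipschitz n\<^esub> y = \<zero>\<^bsub>lipschitz n\<^esub>" if xy: "x \<in> X" "y \<in> X" for x y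
  proof -
    obtain q q' where "x = f q" "y = f q'"
      using xy unfolding X_def by blast
    then obtain a b c d a' b' c' d' where x: "x = f (a, b, c, d)" and y: "y = f (a', b', c', d')"
      by (metis prod_cases4)
    have "n dvd int s * u * (int s * v)" for u v
      using dvd_mult2[OF ss, of "u * v"] by (simp add: mult_ac)
    then show ?thesis
      unfolding x y f_def prod.case lipschitz_mult[OF n] lipschitz_zero prod.inject
      by (intro conjI dvd_imp_mod_0 dvd_add dvd_diff)
  qed
  moreover have "finite (carrier (lipschitz n))" by (simp add: lipschitz_carrier)
  ultimately have "2 * (real (card X) - 1) \<le> graph_energy (lipschitz_graph n)"
    unfolding lipschitz_graph_def using card(2) by (intro zero_divisor_graph_energy_ge) auto
  then show ?thesis unfolding card(1) n_def by simp
qed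

section \<open>The graph modulo two\<close>

text \<open>In characteristic two the imaginary parts of \<open>x \<otimes> x\<close> cancel in pairs and its real part is the
  sum of the coordinates. So \<open>x \<otimes> x\<close> is zero or one, which makes \<open>x\<close> a zero divisor or a unit.\<close>

lemma lipschitz_2_zero_divisors:
  "nonzero_zero_divisors (lipschitz 2) =
    set [(1,1,1,1), (1,1,0,0), (0,0,1,1), (1,0,1,0), (0,1,0,1), (1,0,0,1), (0,1,1,0)]"
proof -
  interpret L: ring "lipschitz 2" by (rule lipschitz_ring) simp
  have square: "x \<otimes>\<^bsub>lipschitz 2\<^esub> x = ((a + b + c + d) mod 2, 0, 0, 0)"
    if "x \<in> carrier (lipschitz 2)" "x = (a, b, c, d)" for x a b c d
  proof -
    have bit: "u * u = u" if "u \<in> {0..2 - 1}" for u :: int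
      using that by (cases "u = 0") auto
    have "a * a = a" "b * b = b" "c * c = c" "d * d = d"
      using that unfolding lipschitz_carrier that(2) mem_Times_iff fst_conv snd_conv
      by (blast intro: bit)+
    then have "a * a - b * b - c * c - d * d = a - b - c - d"
      by (simp only:)
    also have "\<dots> mod 2 = (a + b + c + d) mod 2"
      by presburger
    finally show ?thesis
      unfolding that(2) by (simp add: lipschitz_mult mult.commute)
  qed
  have "x \<in> nonzero_zero_divisors (lipschitz 2) \<longleftrightarrow>
      x \<in> carrier (lipschitz 2) - {\<zero>\<^bsub>lipschitz 2\<^esub>} \<and> even (a + b + c + d)"
    if x: "x = (a, b, c, d)" for x a b c d
  proof (cases "even (a + b + c + d)")
    case True
    then have "x \<otimes>\<^bsub>lipschitz 2\<^esub> x = \<zero>\<^bsub>lipschitz 2\<^esub>" if "x \<in> carrier (lipschitz 2)"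
      using square[OF that x] by (simp add: lipschitz_zero)
    then show ?thesis using True by (auto simp: nonzero_zero_divisors_def)
  next
    case False
    have "y = \<zero>\<^bsub>lipschitz 2\<^esub>"
      if xy: "x \<in> carrier (lipschitz 2)" "y \<in> carrier (lipschitz 2)"
        "x \<otimes>\<^bsub>lipschitz 2\<^esub> y = \<zero>\<^bsub>lipschitz 2\<^esub> \<or> y \<otimes>\<^bsub>lipschitz 2\<^esub> x = \<zero>\<^bsub>lipschitz 2\<^esub>" for y
    proof -
      have "(a + b + c + d) mod 2 = 1"
        using False by presburger
      then have "x \<otimes>\<^bsub>lipschitz 2\<^esub> x = \<one>\<^bsub>lipschitz 2\<^esub>"
        using square[OF xy(1) x] by (simp add: lipschitz_one)
      then show ?thesis
        using xy L.m_assoc[of x x y] L.m_assoc[of y x x] by auto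
    qed
    then show ?thesis using False unfolding nonzero_zero_divisors_def by blast
  qed
  then have char: "(a, b, c, d) \<in> nonzero_zero_divisors (lipschitz 2) \<longleftrightarrow>
      (a, b, c, d) \<in> carrier (lipschitz 2) - {\<zero>\<^bsub>lipschitz 2\<^esub>} \<and> even (a + b + c + d)" for a b c d
    by blast
  have bits: "u \<in> {0..2 - 1} \<longleftrightarrow> u = 0 \<or> u = 1" for u :: int by auto
  show ?thesis
  proof (rule Set.set_eqI)
    fix x :: "int \<times> int \<times> int \<times> int"
    obtain a b c d where x: "x = (a, b, c, d)" by (cases x) auto
    show "x \<in> nonzero_zero_divisors (lipschitz 2) \<longleftrightarrow>
      x \<in> set [(1,1,1,1), (1,1,0,0), (0,0,1,1), (1,0,1,0), (0,1,0,1), (1,0,0,1), (0,1,1,0)]"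
    proof (cases "(a = 0 \<or> a = 1) \<and> (b = 0 \<or> b = 1) \<and> (c = 0 \<or> c = 1) \<and> (d = 0 \<or> d = 1)")
      case True
      then show ?thesis
        unfolding x char lipschitz_carrier lipschitz_zero mem_Times_iff Diff_iff fst_conv snd_conv bits
        by (elim conjE disjE) simp_all
    next
      case False
      then show ?thesis
        unfolding x char lipschitz_carrier lipschitz_zero mem_Times_iff Diff_iff fst_conv snd_conv bits
        by auto
    qed
  qed
qed

text \<open>The adjacency matrix of the friendship graph of three triangles with common vertex \<open>0\<close>: the
  function \<open>r \<mapsto> (r + 1) div 2\<close> is constant exactly on the pairs \<open>{1, 2}\<close>, \<open>{3, 4}\<close>, \<open>{5, 6}\<close>
  opposite to that vertex.\<close>

definition friendship_matrix :: "complex mat" where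
  "friendship_matrix = mat 7 7 (\<lambda>(r, s).
     if r \<noteq> s \<and> (r = 0 \<or> s = 0 \<or> (r + 1) div 2 = (s + 1) div 2) then 1 else 0)"

lemma less_7_cases: "(r :: nat) < 7 \<longleftrightarrow> r = 0 \<or> r = 1 \<or> r = 2 \<or> r = 3 \<or> r = 4 \<or> r = 5 \<or> r = 6"
  by presburger

lemma friendship_matrix_energy: "matrix_energy friendship_matrix = 10"
proof -
  define es :: "complex list" where "es = [3, -2, -1, -1, -1, 1, 1]"
  define D where "D = mat 7 7 (\<lambda>(r, s). if r = s then es ! r else 0)"
  \<comment> \<open>The columns of \<open>P\<close> are eigenvectors: those that are constant on the outer vertices (with
    \<open>\<lambda>\<^sup>2 = \<lambda> + 6\<close>), then those supported on a single pair and antisymmetric there, then those constant on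
    each pair with total zero. \<open>Q\<close> is the inverse of \<open>P\<close>.\<close>
  define P :: "complex mat" where "P = mat_of_rows_list 7
    [[2, -3,  0,  0,  0,  0,  0],
     [1,  1,  1,  0,  0,  1,  0],
     [1,  1, -1,  0,  0,  1,  0],
     [1,  1,  0,  1,  0, -1,  1],
     [1,  1,  0, -1,  0, -1,  1],
     [1,  1,  0,  0,  1,  0, -1],
     [1,  1,  0,  0, -1,  0, -1]]"
  define Q :: "complex mat" where "Q = mat_of_rows_list 7
    [[ 1/5, 1/10,  1/10,  1/10,  1/10,  1/10,  1/10],
     [-1/5, 1/15,  1/15,  1/15,  1/15,  1/15,  1/15],
     [   0,  1/2,  -1/2,     0,     0,     0,     0],
     [   0,    0,     0,   1/2,  -1/2,     0,     0],
     [   0,    0,     0,     0,     0,   1/2,  -1/2],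
     [   0,  1/3,   1/3,  -1/6,  -1/6,  -1/6,  -1/6],
     [   0,  1/6,   1/6,   1/6,   1/6,  -1/3,  -1/3]]"
  let ?A = friendship_matrix
  have dims: "?A \<in> carrier_mat 7 7" "D \<in> carrier_mat 7 7" "P \<in> carrier_mat 7 7" "Q \<in> carrier_mat 7 7"
    by (auto simp: friendship_matrix_def D_def P_def Q_def mat_of_rows_list_def)
  have sum7: "(\<Sum>i = 0..<7. f i) = f 0 + f 1 + f 2 + f 3 + f 4 + f 5 + (f 6 :: complex)" for f :: "nat \<Rightarrow> complex"
    by (simp add: eval_nat_numeral)
  have PQ: "P * Q = 1\<^sub>m 7"
  proof (rule eq_matI)
    fix r s assume "r < dim_row (1\<^sub>m 7 :: complex mat)" "s < dim_col (1\<^sub>m 7 :: complex mat)"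
    then have rs: "r < 7" "s < 7" by auto
    then have "(P * Q) $$ (r, s) = (\<Sum>i = 0..<7. P $$ (r, i) * Q $$ (i, s))"
      using dims by (simp add: scalar_prod_def)
    then show "(P * Q) $$ (r, s) = 1\<^sub>m 7 $$ (r, s)"
      unfolding sum7 using rs[unfolded less_7_cases]
      by (elim disjE) (simp_all add: P_def Q_def mat_of_rows_list_def)
  qed (use dims in auto)
  then have QP: "Q * P = 1\<^sub>m 7"
    using mat_mult_left_right_inverse dims by blast
  have AP: "?A * P = P * D"
  proof (rule eq_matI)
    fix r s assume "r < dim_row (P * D)" "s < dim_col (P * D)"
    then have rs: "r < 7" "s < 7" using dims by auto
    then have "(?A * P) $$ (r, s) = (\<Sum>i = 0..<7. ?A $$ (r, i) * P $$ (i, s))"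
      "(P * D) $$ (r, s) = (\<Sum>i = 0..<7. P $$ (r, i) * D $$ (i, s))"
      using dims by (simp_all add: scalar_prod_def)
    then show "(?A * P) $$ (r, s) = (P * D) $$ (r, s)"
      unfolding sum7 using rs[unfolded less_7_cases]
      by (elim disjE) (simp_all add: P_def D_def es_def friendship_matrix_def mat_of_rows_list_def)
  qed (use dims in auto)
  have "?A = ?A * (P * Q)" using dims PQ by simp
  also have "\<dots> = P * D * Q" using dims AP by (simp flip: assoc_mult_mat[of ?A 7 7 P 7 Q 7])
  finally have "similar_mat ?A D"
    unfolding similar_mat_def using dims PQ QP by (blast intro: similar_mat_witI)
  then have "char_poly ?A = char_poly D" by (rule char_poly_similar)
  also have "\<dots> = (\<Prod>e\<leftarrow>diag_mat D. [:- e, 1:])"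
    by (rule char_poly_upper_triangular[OF dims(2)]) (auto simp: D_def)
  also have "diag_mat D = es"
    by (rule nth_equalityI) (auto simp: diag_mat_def D_def es_def)
  finally show ?thesis
    by (simp only: matrix_energy_eq_sum_list[OF dims(1)]) (simp add: es_def)
qed

lemma lipschitz_graph_2_energy: "graph_energy (lipschitz_graph 2) = 10"
proof -
  \<comment> \<open>The vertex joined to everything comes first, followed by the three complementary pairs.\<close>
  define vs :: "(int \<times> int \<times> int \<times> int) list" where
    "vs = [(1,1,1,1), (1,1,0,0), (0,0,1,1), (1,0,1,0), (0,1,0,1), (1,0,0,1), (0,1,1,0)]"
  have verts: "nonzero_zero_divisors (lipschitz 2) = set vs"
    unfolding vs_def by (rule lipschitz_2_zero_divisors)
  have mem: "vs ! r \<in> set vs" if "r < 7" for r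
    using that by (intro nth_mem) (simp add: vs_def)
  have "adjacency_matrix (lipschitz_graph 2) vs = friendship_matrix"
  proof (rule eq_matI)
    fix r s assume "r < dim_row friendship_matrix" "s < dim_col friendship_matrix"
    then have rs: "r < 7" "s < 7" by (auto simp: friendship_matrix_def)
    have len: "length vs = 7" by (simp add: vs_def)
    have "(vs ! r, vs ! s) \<in> parcs (lipschitz_graph 2) \<longleftrightarrow> vs ! r \<noteq> vs ! s \<and>
      (vs ! r \<otimes>\<^bsub>lipschitz 2\<^esub> vs ! s = \<zero>\<^bsub>lipschitz 2\<^esub> \<or> vs ! s \<otimes>\<^bsub>lipschitz 2\<^esub> vs ! r = \<zero>\<^bsub>lipschitz 2\<^esub>)"
      using mem[OF rs(1)] mem[OF rs(2)] by (simp add: lipschitz_graph_def zero_divisor_graph_def verts)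
    also have "\<dots> \<longleftrightarrow> r \<noteq> s \<and> (r = 0 \<or> s = 0 \<or> (r + 1) div 2 = (s + 1) div 2)"
      using rs[unfolded less_7_cases]
      by (elim disjE) (simp_all add: vs_def lipschitz_mult lipschitz_zero)
    finally show "adjacency_matrix (lipschitz_graph 2) vs $$ (r, s) = friendship_matrix $$ (r, s)"
      using rs len by (simp add: adjacency_matrix_def friendship_matrix_def)
  qed (auto simp: adjacency_matrix_def friendship_matrix_def vs_def)
  moreover have "graph_energy (lipschitz_graph 2) = matrix_energy (adjacency_matrix (lipschitz_graph 2) vs)"
  proof (rule graph_energy_eq)
    show "set vs = pverts (lipschitz_graph 2)"
      by (simp add: lipschitz_graph_def zero_divisor_graph_def verts)
  qed (simp add: vs_def)
  ultimately show ?thesis by (simp add: friendship_matrix_energy)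
qed

theorem theorem7p8:
  shows "graph_energy (lipschitz_graph 2) = 10 \<and>
    (\<forall>t::nat. t \<ge> 2 \<longrightarrow> graph_energy (lipschitz_graph (2 ^ t)) \<ge> 2 ^ (4 * (t div 2) + 1) - 4)"
proof (intro conjI allI impI)
  show "graph_energy (lipschitz_graph 2) = 10" by (rule lipschitz_graph_2_energy)
next
  fix t :: nat assume t: "t \<ge> 2"
  define m where "m = t div 2"
  have m: "1 \<le> m" "2 * m \<le> t" using t by (auto simp: m_def)
  have st: "2 ^ (t - m) * 2 ^ m = (2 :: nat) ^ t"
    using m by (simp flip: power_add)
  have "(2 :: nat) ^ t dvd 2 ^ (t - m) * 2 ^ (t - m)"
    using m by (simp flip: power_add add: le_imp_power_dvd)
  moreover have "(2 :: nat) ^ 1 \<le> 2 ^ m" using m(1) by (rule power_increasing) simp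
  ultimately have "2 * (real (2 ^ m) ^ 4 - 2) \<le> graph_energy (lipschitz_graph (int (2 ^ t)))"
    using lipschitz_graph_energy_ge[of "2 ^ (t - m)" "2 ^ m"] unfolding st by simp
  then show "graph_energy (lipschitz_graph (2 ^ t)) \<ge> 2 ^ (4 * (t div 2) + 1) - 4"
    unfolding m_def[symmetric] by (simp add: mult.commute flip: power_mult)
qed

end
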